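(* For the CB process $(Z_t)_{t\ge0}$ with branching mechanism $\psi$, potential measure $G(x,\mathrm{d}y)$ and extinction time $\zeta$, the following statements are equivalent: (i) $G(x,\mathrm{d}y)$ is a finite measure on $(0,+\infty)$ for some (and then all) $x>0$. (ii) $\mathbb{P}_x[\zeta]<+\infty$ for some (and then all) $x>0$. (iii) The branching mechanism $\psi$ satisfies $\int_{0+}\frac{u}{\psi(u)}\,\mathrm{d}u<+\infty$ (integrability at $0$).
   Context: Branching mechanism: $\psi(\lambda)=\alpha\lambda+\frac12\sigma^2\lambda^2+\int_0^{+\infty}(e^{-\lambda r}-1+\lambda r)\,\pi(\mathrm{d}r)$, $\lambda\ge 0$, where $\alpha\ge 0$, $\sigma\ge 0$ and $\pi$ is a positive Radon measure on $(0,+\infty)$ with $\int_0^{+\infty}(r\wedge r^2)\,\pi(\mathrm{d}r)<+\infty$. It is assumed that $\psi(+\infty)=+\infty$ and $\int^{+\infty}\frac{1}{\psi(\lambda)}\,\mathrm{d}\lambda<+\infty$ (integrability at $+\infty$). CB process: $((Z_t)_{t\ge 0},(\mathbb{P}_x)_{x\ge 0})$ is the $[0,+\infty)$-valued right continuous strong Markov process with left limits, absorbed at $0$, with $\mathbb{P}_x(Z_0=x)=1$, and such that $\mathbb{P}_x[e^{-\lambda Z_t}]=e^{-x u_t(\lambda)}$ for $\lambda>0$, $t\ge 0$, where $\frac{\partial}{\partial t}u_t(\lambda)=-\psi(u_t(\lambda))$, $u_0(\lambda)=\lambda$. $\mathbb{P}_x[\cdot]$ also denotes expectation with respect to $\mathbb{P}_x$.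 The extinction time is $\zeta:=\inf\{t>0: Z_t=0\}$. Potential measure: for $x>0$ and Borel $A\subset(0,+\infty)$, $G(x,A):=\int_0^{+\infty}\mathbb{P}_x(Z_t\in A)\,\mathrm{d}t\in[0,+\infty]$. *)

theory Defs
  imports "HOL-Probability.Probability" "HOL-Probability.Stopping_Time"
begin

definition branching_mechanism :: "real \<Rightarrow> real \<Rightarrow> real measure \<Rightarrow> real \<Rightarrow> real" where
  "branching_mechanism \<alpha> \<sigma> \<pi> l =
     \<alpha> * l + 1 / 2 * \<sigma>\<^sup>2 * l\<^sup>2 + (\<integral>r. exp (- l * r) - 1 + l * r \<partial>\<pi>)"

(* Only the values for l >= 0 are meaningful. Under these assumptions the mechanism is
   strictly positive on (0, infinity), so that no quotient by it there is a division by 0. *)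
locale branching =
  fixes \<alpha> \<sigma> :: real and \<pi> :: "real measure"
  assumes drift_nonneg: "\<alpha> \<ge> 0"
    and diffusion_nonneg: "\<sigma> \<ge> 0"
    and sets_pi: "sets \<pi> = sets (restrict_space borel {0<..})"
    and radon_pi: "\<And>K. compact K \<Longrightarrow> K \<subseteq> {0<..} \<Longrightarrow> emeasure \<pi> K < \<infinity>"
    and moment_pi: "(\<integral>\<^sup>+r. ennreal (min r (r\<^sup>2)) \<partial>\<pi>) < \<infinity>"
    and psi_at_top: "filterlim (branching_mechanism \<alpha> \<sigma> \<pi>) at_top at_top"
    and inverse_psi_integrable_at_top:
      "\<exists>a>0. set_integrable lborel {a..} (\<lambda>l. 1 / branching_mechanism \<alpha> \<sigma> \<pi> l)"

(* The natural filtration of Z, indexed by [0, infinity] (type ennreal) so that stopping times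
   may take the value infinity; the index infinity gives the sigma-algebra generated by all
   the Z s, s >= 0. *)
definition natural_filtration ::
    "'w measure \<Rightarrow> (real \<Rightarrow> 'w \<Rightarrow> real) \<Rightarrow> ennreal \<Rightarrow> 'w measure" where
  "natural_filtration M Z t =
     sigma (space M) {Z s -` B \<inter> space M | s B. 0 \<le> s \<and> ennreal s \<le> t \<and> B \<in> sets borel}"

(* A [0, infinity)-valued cadlag strong Markov process: M carries the sample space, P x is the
   law under which the process starts from x; negative starting points and negative times are
   irrelevant. The strong Markov property reads
     E_x [f (Z (T + t)) | F_T] = E_(Z T) [f (Z t)]   P_x-a.s. on {T < infinity}. *)
locale strong_markov_process =
  fixes M :: "'w measure" and P :: "real \<Rightarrow> 'w measure" and Z :: "real \<Rightarrow> 'w \<Rightarrow> real"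
  assumes prob_P: "\<And>x. x \<ge> 0 \<Longrightarrow> prob_space (P x)"
    and sets_P: "\<And>x. x \<ge> 0 \<Longrightarrow> sets (P x) = sets M"
    and measurable_Z: "\<And>t. t \<ge> 0 \<Longrightarrow> Z t \<in> borel_measurable M"
    and nonneg_Z: "\<And>t \<omega>. t \<ge> 0 \<Longrightarrow> \<omega> \<in> space M \<Longrightarrow> Z t \<omega> \<ge> 0"
    and right_continuous_Z:
      "\<And>t \<omega>. t \<ge> 0 \<Longrightarrow> \<omega> \<in> space M \<Longrightarrow> continuous (at_right t) (\<lambda>s. Z s \<omega>)"
    and left_limits_Z:
      "\<And>t \<omega>. t > 0 \<Longrightarrow> \<omega> \<in> space M \<Longrightarrow> \<exists>l. ((\<lambda>s. Z s \<omega>) \<longlongrightarrow> l) (at_left t)"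
    and initial_Z: "\<And>x. x \<ge> 0 \<Longrightarrow> AE \<omega> in P x. Z 0 \<omega> = x"
    and measurable_transition: "\<And>t B. t \<ge> 0 \<Longrightarrow> B \<in> sets borel \<Longrightarrow>
      (\<lambda>x. measure (P x) {\<omega> \<in> space M. Z t \<omega> \<in> B}) \<in> borel_measurable (restrict_space borel {0..})"
    and strong_markov: "\<And>x T t f. x \<ge> 0 \<Longrightarrow> stopping_time (natural_filtration M Z) T \<Longrightarrow> t \<ge> 0 \<Longrightarrow>
      f \<in> borel_measurable borel \<Longrightarrow> bounded (range f) \<Longrightarrow>
      (AE \<omega> in P x. T \<omega> < \<infinity> \<longrightarrow>
         real_cond_exp (P x) (filtration.pre_sigma (space M) (natural_filtration M Z) T)
           (\<lambda>\<omega>'. indicator {\<omega>'. T \<omega>' < \<infinity>} \<omega>' * f (Z (enn2real (T \<omega>') + t) \<omega>')) \<omega> =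
         (\<integral>\<omega>'. f (Z t \<omega>') \<partial>P (Z (enn2real (T \<omega>)) \<omega>)))"

locale cb_process = branching \<alpha> \<sigma> \<pi> + strong_markov_process M P Z
  for \<alpha> \<sigma> :: real and \<pi> :: "real measure" and u :: "real \<Rightarrow> real \<Rightarrow> real"
    and M :: "'w measure" and P :: "real \<Rightarrow> 'w measure" and Z :: "real \<Rightarrow> 'w \<Rightarrow> real" +
  assumes absorbed_Z: "\<And>s t \<omega>. 0 \<le> s \<Longrightarrow> s \<le> t \<Longrightarrow> \<omega> \<in> space M \<Longrightarrow> Z s \<omega> = 0 \<Longrightarrow> Z t \<omega> = 0"
    and u_nonneg: "\<And>l t. l > 0 \<Longrightarrow> t \<ge> 0 \<Longrightarrow> u t l \<ge> 0"
    and u_zero: "\<And>l. l > 0 \<Longrightarrow> u 0 l = l"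
    and u_deriv: "\<And>l t. l > 0 \<Longrightarrow> t \<ge> 0 \<Longrightarrow>
      ((\<lambda>s. u s l) has_real_derivative - branching_mechanism \<alpha> \<sigma> \<pi> (u t l)) (at t within {0..})"
    and laplace_Z: "\<And>x l t. x \<ge> 0 \<Longrightarrow> l > 0 \<Longrightarrow> t \<ge> 0 \<Longrightarrow>
      (\<integral>\<omega>. exp (- l * Z t \<omega>) \<partial>P x) = exp (- x * u t l)"

(* Infinite if 0 is never hit. *)
definition extinction_time :: "(real \<Rightarrow> 'w \<Rightarrow> real) \<Rightarrow> 'w \<Rightarrow> ennreal" where
  "extinction_time Z \<omega> = Inf {ennreal t | t. t > 0 \<and> Z t \<omega> = 0}"

definition potential_measure ::
    "(real \<Rightarrow> 'w measure) \<Rightarrow> (real \<Rightarrow> 'w \<Rightarrow> real) \<Rightarrow> real \<Rightarrow> real measure" where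
  "potential_measure P Z x = measure_of {0<..} (sets (restrict_space borel {0<..}))
     (\<lambda>A. \<integral>\<^sup>+t\<in>{0..}. emeasure (P x) {\<omega> \<in> space (P x). Z t \<omega> \<in> A} \<partial>lborel)"

lemma measurable_right_continuous_process:
  fixes Z :: "real \<Rightarrow> 'w \<Rightarrow> real"
  assumes Z: "\<And>t. t \<ge> 0 \<Longrightarrow> Z t \<in> borel_measurable M"
    and rc: "\<And>t \<omega>. t \<ge> 0 \<Longrightarrow> \<omega> \<in> space M \<Longrightarrow> continuous (at_right t) (\<lambda>s. Z s \<omega>)"
  shows "(\<lambda>(t, \<omega>). Z (max 0 t) \<omega>) \<in> borel_measurable (borel \<Otimes>\<^sub>M M)"
proof -
  define q where "q n t = (of_int (\<lfloor>real (Suc n) * max 0 t\<rfloor> + 1)) / real (Suc n)" for n t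
  have q_gt: "q n t > max 0 t" and q_le: "q n t \<le> max 0 t + 1 / real (Suc n)" for n t
  proof -
    have "real (Suc n) * max 0 t < of_int (\<lfloor>real (Suc n) * max 0 t\<rfloor> + 1)" by linarith
    then show "q n t > max 0 t" unfolding q_def by (simp add: pos_less_divide_eq mult.commute del: of_nat_Suc max_less_iff_conj)
    have "of_int (\<lfloor>real (Suc n) * max 0 t\<rfloor> + 1) \<le> real (Suc n) * max 0 t + 1" by linarith
    then have "q n t \<le> (real (Suc n) * max 0 t + 1) / real (Suc n)"
      unfolding q_def by (intro divide_right_mono) auto
    also have "\<dots> = max 0 t + 1 / real (Suc n)" by (simp add: add_divide_distrib del: of_nat_Suc)
    finally show "q n t \<le> max 0 t + 1 / real (Suc n)" .
  qed
  have lim_q: "(\<lambda>n. q n t) \<longlonglongrightarrow> max 0 t" for t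
  proof (rule tendsto_sandwich[OF _ _ tendsto_const])
    show "eventually (\<lambda>n. max 0 t \<le> q n t) sequentially" using q_gt by (simp add: less_imp_le)
    show "eventually (\<lambda>n. q n t \<le> max 0 t + 1 / real (Suc n)) sequentially" using q_le by simp
    show "(\<lambda>n. max 0 t + 1 / real (Suc n)) \<longlonglongrightarrow> max 0 t"
      using tendsto_add[OF tendsto_const LIMSEQ_inverse_real_of_nat] by (simp add: inverse_eq_divide)
  qed
  show ?thesis
  proof (rule borel_measurable_LIMSEQ_metric)
    fix n
    have 1: "(\<lambda>(t::real, \<omega>). Z (of_int (max 0 k) / real (Suc n)) \<omega>) \<in> borel_measurable (borel \<Otimes>\<^sub>M M)"
      for k :: int
      using Z[of "of_int (max 0 k) / real (Suc n)"] by measurable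
    have 2: "(\<lambda>p. \<lfloor>real (Suc n) * max 0 (fst p)\<rfloor> + 1)
        \<in> (borel \<Otimes>\<^sub>M M) \<rightarrow>\<^sub>M count_space UNIV"
      by measurable
    have "(\<lambda>p. (\<lambda>k p. (\<lambda>(t::real, \<omega>). Z (of_int (max 0 k) / real (Suc n)) \<omega>) p)
        (\<lfloor>real (Suc n) * max 0 (fst p)\<rfloor> + 1) p) \<in> borel_measurable (borel \<Otimes>\<^sub>M M)"
      by (rule measurable_compose_countable[OF _ 2]) (rule 1)
    also have "(\<lambda>p. (\<lambda>k p. (\<lambda>(t::real, \<omega>). Z (of_int (max 0 k) / real (Suc n)) \<omega>) p)
        (\<lfloor>real (Suc n) * max 0 (fst p)\<rfloor> + 1) p) = (\<lambda>(t, \<omega>). Z (q n t) \<omega>)"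
    proof (intro ext, clarify)
      fix t \<omega>
      have "0 \<le> \<lfloor>real (Suc n) * max 0 t\<rfloor> + 1" by (simp add: add_nonneg_nonneg)
      then have "max 0 (\<lfloor>real (Suc n) * max 0 t\<rfloor> + 1) = \<lfloor>real (Suc n) * max 0 t\<rfloor> + 1"
        by (rule max_absorb2)
      then show "Z (of_int (max 0 (\<lfloor>real (Suc n) * max 0 (fst (t, \<omega>))\<rfloor> + 1)) / real (Suc n)) \<omega> = Z (q n t) \<omega>"
        by (simp only: q_def fst_conv)
    qed
    finally show "(\<lambda>(t, \<omega>). Z (q n t) \<omega>) \<in> borel_measurable (borel \<Otimes>\<^sub>M M)" .
  next
    fix p :: "real \<times> 'w" assume "p \<in> space (borel \<Otimes>\<^sub>M M)"
    then obtain t \<omega> where p: "p = (t, \<omega>)" "\<omega> \<in> space M" by (auto simp: space_pair_measure)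
    have "((\<lambda>s. Z s \<omega>) \<longlongrightarrow> Z (max 0 t) \<omega>) (at_right (max 0 t))"
      using rc[of "max 0 t" \<omega>] p by (simp add: continuous_within)
    moreover have "filterlim (\<lambda>n. q n t) (at_right (max 0 t)) sequentially"
      using lim_q q_gt by (auto simp: filterlim_at intro!: always_eventually simp: less_imp_neq[symmetric] order.strict_implies_not_eq)
    ultimately have "(\<lambda>n. Z (q n t) \<omega>) \<longlonglongrightarrow> Z (max 0 t) \<omega>"
      by (rule filterlim_compose)
    then show "(\<lambda>n. case p of (t, \<omega>) \<Rightarrow> Z (q n t) \<omega>) \<longlonglongrightarrow> (case p of (t, \<omega>) \<Rightarrow> Z (max 0 t) \<omega>)"
      by (simp add: p)
  qed
qed

(* The set function in the definition of the potential measure really is a measure, so that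
   measure_of does not fall back to the null measure. *)
lemma (in strong_markov_process) emeasure_potential_measure:
  assumes x: "x \<ge> 0" and A: "A \<in> sets borel" "A \<subseteq> {0<..}"
  shows "emeasure (potential_measure P Z x) A =
    (\<integral>\<^sup>+t\<in>{0..}. emeasure (P x) {\<omega> \<in> space (P x). Z t \<omega> \<in> A} \<partial>lborel)"
proof -
  interpret prob_space "P x" by (rule prob_P[OF x])
  define \<mu> where "\<mu> A = (\<integral>\<^sup>+t\<in>{0..}. emeasure (P x) {\<omega> \<in> space (P x). Z t \<omega> \<in> A} \<partial>lborel)" for A
  have sp: "space (P x) = space M" by (rule sets_eq_imp_space_eq[OF sets_P[OF x]])
  have Zm: "Z t \<in> borel_measurable (P x)" if "t \<ge> 0" for t
    using measurable_Z[OF that] measurable_cong_sets[OF sets_P[OF x] refl] by blast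
  have [measurable]: "(\<lambda>(t, \<omega>). Z (max 0 t) \<omega>) \<in> borel_measurable (borel \<Otimes>\<^sub>M P x)"
    by (rule measurable_right_continuous_process) (auto intro: Zm right_continuous_Z simp: sp)
  have meas: "(\<lambda>t. emeasure (P x) {\<omega> \<in> space (P x). Z t \<omega> \<in> B} * indicator {0..} t)
      \<in> borel_measurable lborel" if [measurable]: "B \<in> sets borel" for B
  proof -
    have "(\<lambda>t. emeasure (P x) {\<omega> \<in> space (P x). Z (max 0 t) \<omega> \<in> B} * indicator {0..} t)
      \<in> borel_measurable lborel" by measurable
    also have "(\<lambda>t. emeasure (P x) {\<omega> \<in> space (P x). Z (max 0 t) \<omega> \<in> B} * indicator {0..} t) =
      (\<lambda>t. emeasure (P x) {\<omega> \<in> space (P x). Z t \<omega> \<in> B} * indicator {0..} t)"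
      by (auto simp: fun_eq_iff indicator_def max_absorb2)
    finally show ?thesis .
  qed
  have pm: "potential_measure P Z x = measure_of {0<..} (sets (restrict_space borel {0<..})) \<mu>"
    unfolding potential_measure_def \<mu>_def ..
  have "emeasure (potential_measure P Z x) A = \<mu> A"
  proof (rule emeasure_measure_of[OF pm])
    show "sets (restrict_space borel {0<..}) \<subseteq> Pow ({0<..} :: real set)"
      by (auto simp: sets_restrict_space)
    have s: "sets (potential_measure P Z x) = sets (restrict_space borel {0<..})"
      using sets.sets_measure_of_eq[of "restrict_space borel {0<..} :: real measure"]
      by (simp add: pm space_restrict_space)
    show "A \<in> sets (potential_measure P Z x)"
      unfolding s using A by (auto simp: sets_restrict_space_iff)
    show "positive (sets (potential_measure P Z x)) \<mu>" by (simp add: positive_def \<mu>_def)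
    show "countably_additive (sets (potential_measure P Z x)) \<mu>"
      unfolding countably_additive_def
    proof (intro allI impI)
      fix B :: "nat \<Rightarrow> real set"
      assume "range B \<subseteq> sets (potential_measure P Z x)" and disj: "disjoint_family B"
      then have B: "B i \<in> sets borel" for i
        unfolding s by (auto simp: sets_restrict_space_iff image_subset_iff)
      have "(\<Sum>i. \<mu> (B i)) = (\<integral>\<^sup>+t. (\<Sum>i. emeasure (P x) {\<omega> \<in> space (P x). Z t \<omega> \<in> B i} * indicator {0..} t) \<partial>lborel)"
        unfolding \<mu>_def by (rule nn_integral_suminf[symmetric]) (rule meas[OF B])
      also have "\<dots> = \<mu> (\<Union>i. B i)"
        unfolding \<mu>_def
      proof (rule nn_integral_cong)
        fix t :: real
        show "(\<Sum>i. emeasure (P x) {\<omega> \<in> space (P x). Z t \<omega> \<in> B i} * indicator {0..} t) =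
          emeasure (P x) {\<omega> \<in> space (P x). Z t \<omega> \<in> (\<Union>i. B i)} * indicator {0..} t"
        proof (cases "t \<ge> 0")
          case True
          have "(\<Sum>i. emeasure (P x) {\<omega> \<in> space (P x). Z t \<omega> \<in> B i}) =
            emeasure (P x) (\<Union>i. {\<omega> \<in> space (P x). Z t \<omega> \<in> B i})"
          proof (rule suminf_emeasure)
            show "range (\<lambda>i. {\<omega> \<in> space (P x). Z t \<omega> \<in> B i}) \<subseteq> sets (P x)"
              using measurable_sets[OF Zm[OF True] B] by (auto simp: vimage_def Int_def conj_commute)
            show "disjoint_family (\<lambda>i. {\<omega> \<in> space (P x). Z t \<omega> \<in> B i})"
              using disj by (auto simp: disjoint_family_on_def)
          qed
          also have "(\<Union>i. {\<omega> \<in> space (P x). Z t \<omega> \<in> B i}) = {\<omega> \<in> space (P x). Z t \<omega> \<in> (\<Union>i. B i)}"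
            by auto
          finally show ?thesis using True by simp
        qed simp
      qed
      finally show "(\<Sum>i. \<mu> (B i)) = \<mu> (\<Union>i. B i)" .
    qed
  qed
  then show ?thesis by (simp add: \<mu>_def)
qed

end

theory Submission
  imports Defs
begin

text \<open>
  All three conditions turn out to be statements about one quantity, the mean time spent in
  \<open>(0, \<infinity>)\<close>. Since \<open>Z\<close> is absorbed at \<open>0\<close>, the extinction time is the Lebesgue measure of
  \<open>{t. Z t > 0}\<close>, so by Tonelli
  \[ E_x[\zeta] = \int_0^\infty P_x(Z_t > 0) dt = G(x, (0,\infty)) , \]
  which settles (i) \<open>\<longleftrightarrow>\<close> (ii) for each fixed \<open>x\<close>
  (\<open>expected_extinction_time_eq_occupation\<close>, \<open>finite_potential_measure_iff\<close>).

  To compute the quantity, note that \<open>1 - exp (- l * Z t)\<close> increases to the indicator of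
  \<open>Z t > 0\<close> as \<open>l \<rightarrow> \<infinity>\<close> and has mean \<open>1 - exp (- x * u t l)\<close>. For fixed \<open>l\<close> the flow
  \<open>t \<mapsto> u t l\<close> decreases strictly from \<open>l\<close> to \<open>0\<close> with speed \<open>\<psi> (u t l)\<close>, and substituting
  \<open>v = u t l\<close> gives
  \[ \int_0^\infty (1 - e^{-x u_t(l)}) dt = \int_0^l (1 - e^{-xv}) / \psi(v) dv \]
  (\<open>time_change\<close>). Letting \<open>l\<close> run through the positive integers, monotone convergence on both
  sides yields
  \[ G(x, (0,\infty)) = \int_0^\infty (1 - e^{-xv}) / \psi(v) dv \]
  (\<open>occupation_eq_integral\<close>). Substituting before passing to the limit means that the limiting
  flow, started from \<open>\<infinity>\<close>, never has to be constructed.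

  The last integral always converges away from \<open>0\<close>, because \<open>1 / \<psi>\<close> is integrable at \<open>\<infinity>\<close> and
  \<open>\<psi>\<close> is bounded below on \<open>[e, \<infinity>)\<close>; near \<open>0\<close> its integrand is comparable to \<open>v / \<psi> v\<close>. Hence
  it is finite iff (iii) holds (\<open>extinction_integral_finite_iff\<close>), a condition that does not
  involve \<open>x\<close>.
\<close>

section \<open>Integrals of nonnegative functions\<close>

text \<open>
  A bridge between the extended nonnegative integral and absolute integrability, which lets the
  change of variables theorem for absolutely integrable functions also carry infinite values.
\<close>
lemma nn_integral_eq_integral_or_top:
  fixes h :: "real \<Rightarrow> real"
  assumes h: "(\<lambda>t. indicator A t * h t) \<in> borel_measurable borel" and nn: "\<And>t. t \<in> A \<Longrightarrow> 0 \<le> h t"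
  shows "(\<integral>\<^sup>+t\<in>A. ennreal (h t) \<partial>lborel) =
    (if h absolutely_integrable_on A then ennreal (integral A h) else \<infinity>)"
proof -
  have eq: "(\<integral>\<^sup>+t\<in>A. ennreal (h t) \<partial>lborel) = (\<integral>\<^sup>+t. ennreal (indicator A t * h t) \<partial>lebesgue)"
    by (simp add: nn_integral_completion) (auto intro!: nn_integral_cong simp: indicator_def)
  have pos: "0 \<le> indicator A t * h t" for t using nn by (auto simp: indicator_def)
  have meas: "(\<lambda>t. indicator A t * h t) \<in> borel_measurable lebesgue"
    using h by (intro measurable_completion) simp
  show ?thesis
  proof (cases "h absolutely_integrable_on A")
    case True
    then have "integrable lebesgue (\<lambda>t. indicator A t * h t)" by (simp add: set_integrable_def)
    from nn_integral_eq_integral[OF this] pos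
    have "(\<integral>\<^sup>+t. ennreal (indicator A t * h t) \<partial>lebesgue) = ennreal (\<integral>t. indicator A t * h t \<partial>lebesgue)"
      by simp
    also have "(\<integral>t. indicator A t * h t \<partial>lebesgue) = integral A h"
      using set_lebesgue_integral_eq_integral(2)[OF True] by (simp add: set_lebesgue_integral_def)
    finally show ?thesis using True eq by simp
  next
    case False
    have "\<not> (\<integral>\<^sup>+t. ennreal (indicator A t * h t) \<partial>lebesgue) < \<infinity>"
      using False integrableI_nonneg[OF meas] pos by (auto simp: set_integrable_def)
    then show ?thesis using False eq by (metis infinity_ennreal_def less_top)
  qed
qed

text \<open>
  The derivative is only required within \<open>S\<close>, as needed for a flow that starts at time \<open>0\<close>.
  Integrability on one side of the substitution is equivalent to integrability on the other, so
  the two sides are also infinite together.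
\<close>
lemma nn_integral_change_of_variables:
  fixes f g g' :: "real \<Rightarrow> real"
  assumes S: "S \<in> sets borel"
    and deriv: "\<And>t. t \<in> S \<Longrightarrow> (g has_field_derivative g' t) (at t within S)"
    and inj: "inj_on g S"
    and nn: "\<And>t. t \<in> S \<Longrightarrow> 0 \<le> f (g t)"
    and meas_f: "(\<lambda>y. indicator (g ` S) y * f y) \<in> borel_measurable borel"
    and meas_g: "(\<lambda>t. indicator S t * (\<bar>g' t\<bar> * f (g t))) \<in> borel_measurable borel"
  shows "(\<integral>\<^sup>+t\<in>S. ennreal (\<bar>g' t\<bar> * f (g t)) \<partial>lborel) = (\<integral>\<^sup>+y\<in>g ` S. ennreal (f y) \<partial>lborel)"
proof -
  have S': "S \<in> sets lebesgue" using S by simp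
  note cov = has_absolute_integral_change_of_variables_1'[where f = f, OF S' deriv inj]
  have "(\<lambda>t. \<bar>g' t\<bar> * f (g t)) absolutely_integrable_on S \<longleftrightarrow> f absolutely_integrable_on g ` S"
    using cov by blast
  moreover have "integral S (\<lambda>t. \<bar>g' t\<bar> * f (g t)) = integral (g ` S) f"
    if "f absolutely_integrable_on g ` S"
    using cov that by blast
  ultimately show ?thesis
    using nn by (subst nn_integral_eq_integral_or_top[OF meas_g], simp)
      (subst nn_integral_eq_integral_or_top[OF meas_f], auto)
qed

lemma nn_set_integral_less_top_iff:
  assumes "(\<lambda>v. indicator A v * f v) \<in> borel_measurable borel" "\<And>v. v \<in> A \<Longrightarrow> 0 \<le> (f v :: real)"
  shows "(\<integral>\<^sup>+v\<in>A. ennreal (f v) \<partial>lborel) < \<infinity> \<longleftrightarrow> set_integrable lborel A f"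
proof -
  have nn: "0 \<le> indicator A v * f v" for v using assms(2) by (auto simp: indicator_def)
  have eq: "(\<integral>\<^sup>+v\<in>A. ennreal (f v) \<partial>lborel) = (\<integral>\<^sup>+v. ennreal (indicator A v * f v) \<partial>lborel)"
    by (auto intro!: nn_integral_cong simp: indicator_def)
  show ?thesis
    unfolding eq set_integrable_def real_scaleR_def integrable_iff_bounded
    using assms(1) by (simp only: real_norm_def abs_of_nonneg[OF nn] measurable_lborel2 simp_thms)
qed

lemma set_integrable_dominated:
  fixes f g :: "real \<Rightarrow> real"
  assumes "set_integrable lborel A g" "set_borel_measurable lborel A f"
    and "\<And>v. v \<in> A \<Longrightarrow> 0 \<le> f v" "\<And>v. v \<in> A \<Longrightarrow> f v \<le> g v"
  shows "set_integrable lborel A f"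
proof (rule set_integrable_bound[OF assms(1,2)], intro AE_I2 impI)
  fix v assume "v \<in> A"
  then have "0 \<le> f v" "f v \<le> g v" using assms(3,4) by auto
  then show "norm (f v) \<le> norm (g v)" by simp
qed

section \<open>Elementary bounds for the exponential\<close>

text \<open>
  The linear bound serves large jumps, the quadratic one small jumps; together they match the
  moment condition on \<open>min r (r\<^sup>2)\<close>.
\<close>
lemma exp_compensated_bounds:
  fixes y :: real
  assumes "y \<ge> 0"
  shows "0 \<le> exp (- y) - 1 + y" "exp (- y) - 1 + y \<le> y" "exp (- y) - 1 + y \<le> y\<^sup>2"
proof -
  show "0 \<le> exp (- y) - 1 + y" using exp_ge_add_one_self[of "- y"] by simp
  show "exp (- y) - 1 + y \<le> y" using assms by simp
  have "exp (- y) \<le> 1 / (1 + y)"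
    using exp_ge_add_one_self[of y] assms by (simp add: exp_minus field_simps)
  also have "\<dots> \<le> 1 - y + y\<^sup>2"
  proof -
    have "(1 - y + y\<^sup>2) * (1 + y) = 1 + y ^ 3" by (simp add: power2_eq_square power3_eq_cube algebra_simps)
    then have "1 \<le> (1 - y + y\<^sup>2) * (1 + y)" using assms by simp
    then show ?thesis using assms by (simp add: divide_le_eq)
  qed
  finally show "exp (- y) - 1 + y \<le> y\<^sup>2" by simp
qed

lemma exp_compensated_mono:
  fixes y z :: real
  assumes "0 \<le> y" "y \<le> z"
  shows "exp (- y) - 1 + y \<le> exp (- z) - 1 + z"
proof -
  have "1 - (z - y) \<le> exp (- (z - y))" using exp_ge_add_one_self[of "-(z-y)"] by linarith
  then have "exp (- y) * (1 - (z - y)) \<le> exp (- y) * exp (- (z - y))" by (intro mult_left_mono) auto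
  also have "\<dots> = exp (- z)" by (simp flip: exp_add)
  finally have "exp (- y) - exp (- z) \<le> exp (- y) * (z - y)" by (simp add: algebra_simps)
  also have "\<dots> \<le> 1 * (z - y)" using assms by (intro mult_right_mono) auto
  finally show ?thesis by simp
qed

lemma exp_compensated_pos:
  fixes y :: real
  assumes "y > 0"
  shows "exp (- y) - 1 + y > 0"
proof -
  have "exp (- y) - 1 + y \<noteq> 0"
    using exp_minus_ge[of y] exp_ge_add_one_self[of "-y"] assms exp_minus_greater[of y] by auto
  then show ?thesis using exp_compensated_bounds(1)[of y] assms by linarith
qed

lemma one_minus_exp_ge:
  fixes y b :: real
  assumes "0 \<le> y" "y \<le> b"
  shows "y / (1 + b) \<le> 1 - exp (- y)"
proof -
  have "exp (- y) \<le> 1 / (1 + y)"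
    using exp_ge_add_one_self[of y] assms by (simp add: exp_minus field_simps)
  then have "1 - 1 / (1 + y) \<le> 1 - exp (- y)" by simp
  moreover have "1 - 1 / (1 + y) = y / (1 + y)" using assms by (simp add: field_simps)
  moreover have "y / (1 + b) \<le> y / (1 + y)" using assms by (intro divide_left_mono) auto
  ultimately show ?thesis by linarith
qed

text \<open>
  This monotone limit turns the Laplace transform of \<open>Z t\<close> into the survival probability.
\<close>
lemma SUP_one_minus_exp:
  fixes z :: real
  assumes "z \<ge> 0"
  shows "(SUP n. ennreal (1 - exp (- real (Suc n) * z))) = indicator {0<..} z"
proof (cases "z = 0")
  case False
  with assms have z: "z > 0" by simp
  show ?thesis
  proof (rule LIMSEQ_unique[OF LIMSEQ_SUP])
    show "incseq (\<lambda>n. ennreal (1 - exp (- real (Suc n) * z)))"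
      using z by (intro monoI ennreal_leI) (auto simp: mult_right_mono)
    have "filterlim (\<lambda>n. real (Suc n) * z) at_top sequentially"
      using z by (intro filterlim_at_top_mult_tendsto_pos[OF tendsto_const] filterlim_compose[OF filterlim_real_sequentially filterlim_Suc]) auto
    then have "(\<lambda>n. exp (- (real (Suc n) * z))) \<longlonglongrightarrow> 0"
      by (intro filterlim_compose[OF exp_at_bot] filterlim_compose[OF filterlim_uminus_at_bot_at_top])
    then have "(\<lambda>n. 1 - exp (- (real (Suc n) * z))) \<longlonglongrightarrow> 1 - 0" by (intro tendsto_intros)
    then have "(\<lambda>n. ennreal (1 - exp (- (real (Suc n) * z)))) \<longlonglongrightarrow> ennreal (1 - 0)"
      by (rule tendsto_ennrealI)
    then show "(\<lambda>n. ennreal (1 - exp (- real (Suc n) * z))) \<longlonglongrightarrow> indicator {0<..} z"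
      using z by (simp only: mult_minus_left diff_0_right ennreal_1 indicator_simps greaterThan_iff)
  qed
qed simp

section \<open>The branching mechanism\<close>

context branching
begin

abbreviation psi :: "real \<Rightarrow> real" where
  "psi \<equiv> branching_mechanism \<alpha> \<sigma> \<pi>"

lemma space_pi: "space \<pi> = {0<..}"
  using sets_eq_imp_space_eq[OF sets_pi] by (simp add: space_restrict_space)

lemma measurable_pi: "f \<in> borel_measurable borel \<Longrightarrow> f \<in> borel_measurable \<pi>"
  using measurable_restrict_space1[of f borel borel] measurable_cong_sets[OF sets_pi refl] by blast

lemma integrable_moment: "integrable \<pi> (\<lambda>r. min r (r\<^sup>2))"
  by (rule integrableI_nonneg) (use moment_pi in \<open>auto simp: space_pi intro!: AE_I2 measurable_pi\<close>)

lemma jump_integrand_le: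
  fixes l L r :: real
  assumes "0 \<le> l" "l \<le> L" "0 < r"
  shows "exp (- l * r) - 1 + l * r \<le> l * max 1 L * min r (r\<^sup>2)"
proof (cases "r \<le> 1")
  case True
  have "exp (- (l * r)) - 1 + l * r \<le> (l * r)\<^sup>2" using exp_compensated_bounds(3)[of "l * r"] assms by simp
  also have "\<dots> = l * l * r\<^sup>2" by (simp add: power2_eq_square)
  also have "\<dots> \<le> l * max 1 L * r\<^sup>2" using assms by (intro mult_right_mono mult_left_mono) auto
  also have "r\<^sup>2 = min r (r\<^sup>2)" using True assms by (simp add: power2_eq_square mult_left_le)
  finally show ?thesis by (simp only: mult_minus_left)
next
  case False
  have "exp (- (l * r)) - 1 + l * r \<le> l * r" using exp_compensated_bounds(2)[of "l * r"] assms by simp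
  also have "\<dots> \<le> l * max 1 L * r" using assms by (intro mult_right_mono mult_left_le[THEN order_trans]) (auto simp: mult_le_cancel_left1)
  also have "l * max 1 L * r = l * max 1 L * min r (r\<^sup>2)" using False by (simp add: power2_eq_square)
  finally show ?thesis by (simp only: mult_minus_left)
qed

lemma integrable_jump:
  assumes "0 \<le> l"
  shows "integrable \<pi> (\<lambda>r. exp (- l * r) - 1 + l * r)"
proof (rule Bochner_Integration.integrable_bound)
  show "integrable \<pi> (\<lambda>r. l * max 1 l * min r (r\<^sup>2))" by (intro integrable_mult_right integrable_moment)
  show "AE r in \<pi>. norm (exp (- l * r) - 1 + l * r) \<le> norm (l * max 1 l * min r (r\<^sup>2))"
  proof (rule AE_I2)
    fix r assume "r \<in> space \<pi>"
    then have r: "0 < r" by (simp add: space_pi)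
    show "norm (exp (- l * r) - 1 + l * r) \<le> norm (l * max 1 l * min r (r\<^sup>2))"
      using jump_integrand_le[OF assms order_refl r] exp_compensated_bounds(1)[of "l * r"] assms r
      by (simp add: abs_of_nonneg)
  qed
qed (rule measurable_pi, simp)

lemma psi_mono:
  assumes "0 \<le> l" "l \<le> l'"
  shows "psi l \<le> psi l'"
proof -
  have 1: "\<alpha> * l \<le> \<alpha> * l'" using assms drift_nonneg by (simp add: mult_left_mono)
  have 2: "1 / 2 * \<sigma>\<^sup>2 * l\<^sup>2 \<le> 1 / 2 * \<sigma>\<^sup>2 * l'\<^sup>2" using assms by (intro mult_left_mono power_mono) auto
  have 3: "(\<integral>r. exp (- l * r) - 1 + l * r \<partial>\<pi>) \<le> (\<integral>r. exp (- l' * r) - 1 + l' * r \<partial>\<pi>)"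
  proof (intro integral_mono_AE AE_I2)
    fix r assume "r \<in> space \<pi>"
    then show "exp (- l * r) - 1 + l * r \<le> exp (- l' * r) - 1 + l' * r"
      using exp_compensated_mono[of "l * r" "l' * r"] assms by (simp add: space_pi mult_right_mono)
  qed (use assms integrable_jump in auto)
  show ?thesis unfolding branching_mechanism_def by (intro add_mono 1 2 3)
qed

lemma psi_nonneg: "0 \<le> l \<Longrightarrow> 0 \<le> psi l"
  using psi_mono[of 0 l] by (simp add: branching_mechanism_def)

text \<open>
  All three summands of \<open>\<psi> l\<close> are nonnegative, and each vanishes for one \<open>l > 0\<close> only if it vanishes
  for every \<open>l\<close>: for the jump part, because its integrand is strictly positive, so that \<open>\<pi>\<close> has to be
  the null measure. Then \<open>\<psi>\<close> would be identically \<open>0\<close>, contradicting its divergence at \<open>\<infinity>\<close>.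
\<close>
lemma psi_pos:
  assumes l: "0 < l"
  shows "0 < psi l"
proof (rule ccontr)
  assume "\<not> 0 < psi l"
  moreover have J: "0 \<le> (\<integral>r. exp (- l * r) - 1 + l * r \<partial>\<pi>)"
    using exp_compensated_bounds(1)[of "l * _"] l by (intro integral_nonneg_AE AE_I2) (simp add: space_pi)
  moreover have "0 \<le> \<alpha> * l" "0 \<le> 1 / 2 * \<sigma>\<^sup>2 * l\<^sup>2" using l drift_nonneg by auto
  ultimately have z: "\<alpha> * l = 0" "1 / 2 * \<sigma>\<^sup>2 * l\<^sup>2 = 0" "(\<integral>r. exp (- l * r) - 1 + l * r \<partial>\<pi>) = 0"
    unfolding branching_mechanism_def by linarith+
  have "AE r in \<pi>. exp (- l * r) - 1 + l * r = 0"
    using z(3) l exp_compensated_bounds(1)[of "l * _"]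
    by (subst (asm) integral_nonneg_eq_0_iff_AE[OF integrable_jump]) (auto intro!: AE_I2 simp: space_pi)
  then have "AE r in \<pi>. False"
    by (rule AE_mp) (use l exp_compensated_pos[of "l * _"] in \<open>auto simp: space_pi less_le intro!: AE_I2\<close>)
  then have "AE r in \<pi>. exp (- m * r) - 1 + m * r = 0" for m by (rule AE_mp) simp
  then have "(\<integral>r. exp (- m * r) - 1 + m * r \<partial>\<pi>) = 0" for m by (rule integral_eq_zero_AE)
  then have "psi = (\<lambda>_. 0)" using z l by (simp add: branching_mechanism_def fun_eq_iff)
  then show False using psi_at_top by (auto simp: filterlim_at_top dest: spec[of _ 1])
qed

text \<open>
  The linear bound keeps the flow \<open>u\<close> away from \<open>0\<close> at finite times.
\<close>
lemma psi_le_linear: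
  obtains C where "\<And>l. 0 \<le> l \<Longrightarrow> l \<le> L \<Longrightarrow> psi l \<le> C * l"
proof
  fix l assume l: "0 \<le> l" "l \<le> L"
  have "(\<integral>r. exp (- l * r) - 1 + l * r \<partial>\<pi>) \<le> (\<integral>r. l * max 1 L * min r (r\<^sup>2) \<partial>\<pi>)"
    using l by (intro integral_mono_AE integrable_jump integrable_mult_right integrable_moment AE_I2
        jump_integrand_le) (auto simp: space_pi)
  also have "\<dots> = l * max 1 L * (\<integral>r. min r (r\<^sup>2) \<partial>\<pi>)" by (rule integral_mult_right_zero)
  finally have J: "(\<integral>r. exp (- l * r) - 1 + l * r \<partial>\<pi>) \<le> l * max 1 L * (\<integral>r. min r (r\<^sup>2) \<partial>\<pi>)" .
  have "l\<^sup>2 \<le> L * l" using l by (simp add: power2_eq_square mult_right_mono)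
  then have "1 / 2 * \<sigma>\<^sup>2 * l\<^sup>2 \<le> 1 / 2 * \<sigma>\<^sup>2 * (L * l)" by (intro mult_left_mono) auto
  with J show "psi l \<le> (\<alpha> + 1 / 2 * \<sigma>\<^sup>2 * L + max 1 L * (\<integral>r. min r (r\<^sup>2) \<partial>\<pi>)) * l"
    unfolding branching_mechanism_def by (simp add: algebra_simps)
qed

lemma measurable_psi_max [measurable]: "(\<lambda>l. psi (max 0 l)) \<in> borel_measurable borel"
  by (rule borel_measurable_mono) (auto simp: mono_def intro!: psi_mono)

text \<open>
  Restricting to \<open>A\<close> is essential: measurability of \<open>\<psi>\<close> comes from its monotonicity, which is
  available on \<open>[0, \<infinity>)\<close> only.
\<close>
lemma measurable_quotient_psi:
  assumes [measurable]: "h \<in> borel_measurable borel" "A \<in> sets borel" and A: "A \<subseteq> {0..}"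
  shows "(\<lambda>v. indicator A v * (h v / psi v)) \<in> borel_measurable borel"
proof -
  have "(\<lambda>v. indicator A v * (h v / psi (max 0 v))) \<in> borel_measurable borel" by measurable
  also have "(\<lambda>v. indicator A v * (h v / psi (max 0 v))) = (\<lambda>v. indicator A v * (h v / psi v))"
    using A by (auto simp: indicator_def fun_eq_iff max_absorb2)
  finally show ?thesis .
qed

text \<open>
  Near \<open>0\<close> the bounds \<open>x * v / (1 + x) \<le> 1 - exp (- x * v) \<le> x * v\<close> (the first for \<open>v \<le> 1\<close>) make the
  integrand comparable to \<open>v / \<psi> v\<close>. On a compact interval in \<open>(0, \<infinity>)\<close> monotonicity bounds \<open>\<psi>\<close>
  below, and at \<open>\<infinity>\<close> the integrand is at most the integrable function \<open>1 / \<psi>\<close>.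
\<close>
lemma extinction_integral_finite_iff:
  assumes x: "0 < x"
  shows "(\<integral>\<^sup>+v\<in>{0<..}. ennreal ((1 - exp (- x * v)) / psi v) \<partial>lborel) < \<infinity> \<longleftrightarrow>
    (\<exists>e>0. set_integrable lborel {0<..<e} (\<lambda>v. v / psi v))"
proof -
  have nn: "0 \<le> (1 - exp (- x * v)) / psi v" if "0 < v" for v
    using x that psi_pos[OF that] by simp
  note fin = nn_set_integral_less_top_iff[OF measurable_quotient_psi]
  let ?f = "\<lambda>v. (1 - exp (- x * v)) / psi v"
  have "(\<integral>\<^sup>+v\<in>{0<..}. ennreal (?f v) \<partial>lborel) < \<infinity> \<longleftrightarrow> set_integrable lborel {0<..} ?f"
    by (rule fin) (use nn in auto)
  also have "\<dots> \<longleftrightarrow> (\<exists>e>0. set_integrable lborel {0<..<e} (\<lambda>v. v / psi v))"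
  proof safe
    assume f: "set_integrable lborel {0<..} ?f"
    have "set_integrable lborel {0<..<1} (\<lambda>v. (1 + x) / x * ?f v)"
      by (intro set_integrable_mult_right set_integrable_subset[OF f]) auto
    then have "set_integrable lborel {0<..<1} (\<lambda>v. v / psi v)"
    proof (rule set_integrable_dominated)
      show "set_borel_measurable lborel {0<..<1} (\<lambda>v. v / psi v)"
        unfolding set_borel_measurable_def real_scaleR_def measurable_lborel2
        by (rule measurable_quotient_psi) auto
    next
      fix v :: real assume "v \<in> {0<..<1}"
      then have v: "0 < v" "v < 1" by auto
      show "0 \<le> v / psi v" using v psi_pos[OF v(1)] by simp
      have "x * v \<le> x * 1" using x v by (intro mult_left_mono) auto
      then have "x * v / (1 + x) \<le> 1 - exp (- (x * v))"
        using x v by (intro one_minus_exp_ge) auto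
      then have "(1 + x) / x * (x * v / (1 + x)) \<le> (1 + x) / x * (1 - exp (- (x * v)))"
        using x by (intro mult_left_mono) auto
      moreover have "(1 + x) / x * (x * v / (1 + x)) = v" using x by (simp add: divide_simps)
      ultimately have "v \<le> (1 + x) / x * (1 - exp (- x * v))" by simp
      from divide_right_mono[OF this less_imp_le[OF psi_pos[OF v(1)]]]
      show "v / psi v \<le> (1 + x) / x * ?f v" by (simp only: times_divide_eq_right)
    qed
    then show "\<exists>e>0. set_integrable lborel {0<..<e} (\<lambda>v. v / psi v)"
      using zero_less_one by blast
  next
    fix e :: real
    assume e: "0 < e" and f: "set_integrable lborel {0<..<e} (\<lambda>v. v / psi v)"
    obtain a where a: "0 < a" "set_integrable lborel {a..} (\<lambda>v. 1 / psi v)"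
      using inverse_psi_integrable_at_top by auto
    have fm: "set_borel_measurable lborel A ?f" if "A \<in> sets borel" "A \<subseteq> {0..}" for A
      unfolding set_borel_measurable_def real_scaleR_def measurable_lborel2
      by (rule measurable_quotient_psi) (use that in auto)
    have 1: "set_integrable lborel {0<..<e} ?f"
    proof (rule set_integrable_dominated[OF set_integrable_mult_right[OF f, of x] fm])
      fix v :: real assume "v \<in> {0<..<e}"
      then have v: "0 < v" by simp
      show "0 \<le> ?f v" by (rule nn[OF v])
      show "?f v \<le> x * (v / psi v)"
        using exp_ge_add_one_self[of "- x * v"] psi_pos[OF v] by (simp add: divide_right_mono)
    qed auto
    have 2: "set_integrable lborel {a..} ?f"
    proof (rule set_integrable_dominated[OF a(2) fm])
      fix v :: real assume "v \<in> {a..}"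
      then have v: "0 < v" using a by simp
      show "0 \<le> ?f v" by (rule nn[OF v])
      show "?f v \<le> 1 / psi v" using psi_pos[OF v] by (simp add: divide_right_mono)
    qed (use a in auto)
    have 3: "set_integrable lborel {e..a} ?f"
    proof (rule set_integrable_dominated[OF _ fm])
      show "set_integrable lborel {e..a} (\<lambda>v. 1 / psi e)"
        unfolding set_integrable_def by (intro integrable_scaleR_left integrable_real_indicator) (auto simp: emeasure_lborel_Icc_eq)
      fix v :: real assume "v \<in> {e..a}"
      then have v: "e \<le> v" "0 < v" using e by auto
      show "0 \<le> ?f v" by (rule nn[OF v(2)])
      show "?f v \<le> 1 / psi e"
        using e x v psi_pos[OF e] psi_mono[of e v] by (intro frac_le) auto
    qed (use e in auto)
    have "set_integrable lborel ({0<..<e} \<union> {e..a} \<union> {a..}) ?f"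
      by (intro set_integrable_Un 1 2 3) auto
    then show "set_integrable lborel {0<..} ?f"
      by (rule set_integrable_subset) auto
  qed
  finally show ?thesis .
qed

end

section \<open>The flow of the Laplace exponent\<close>

context cb_process
begin

lemma u_deriv_at:
  assumes "l > 0" "t > 0"
  shows "((\<lambda>s. u s l) has_real_derivative - psi (u t l)) (at t)"
  using u_deriv[of l t] assms at_within_interior[of t "{0..}"] by simp

lemma continuous_on_u: "l > 0 \<Longrightarrow> continuous_on {0..} (\<lambda>s. u s l)"
  by (rule DERIV_continuous_on[OF u_deriv]) auto

lemma u_antimono:
  assumes "l > 0" "0 \<le> s" "s \<le> t"
  shows "u t l \<le> u s l"
  using assms u_nonneg psi_nonneg
  by (intro DERIV_nonpos_imp_decreasing_open[where f = "\<lambda>s. u s l"] exI[of _ "- psi (u _ l)"])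
    (auto intro!: u_deriv_at continuous_on_subset[OF continuous_on_u])

lemma u_le: "l > 0 \<Longrightarrow> 0 \<le> t \<Longrightarrow> u t l \<le> l"
  using u_antimono[of l 0 t] u_zero[of l] by simp

text \<open>
  By \<open>psi_le_linear\<close>, the flow falls no faster than exponentially: \<open>u s l * exp (C * s)\<close> is
  nondecreasing for a suitable \<open>C\<close>.
\<close>
lemma u_pos:
  assumes l: "l > 0" and t: "0 \<le> t"
  shows "0 < u t l"
proof -
  obtain C where C: "\<And>v. 0 \<le> v \<Longrightarrow> v \<le> l \<Longrightarrow> psi v \<le> C * v" using psi_le_linear by blast
  have "u 0 l * exp (C * 0) \<le> u t l * exp (C * t)"
  proof (rule DERIV_nonneg_imp_increasing_open[OF t, where f = "\<lambda>s. u s l * exp (C * s)"])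
    fix s assume s: "0 < s" "s < t"
    have "((\<lambda>s. u s l * exp (C * s)) has_real_derivative (C * u s l - psi (u s l)) * exp (C * s)) (at s)"
      using l s by (auto intro!: derivative_eq_intros u_deriv_at simp: algebra_simps)
    moreover have "0 \<le> (C * u s l - psi (u s l)) * exp (C * s)"
      using C[of "u s l"] u_nonneg[of l s] u_le[of l s] l s by simp
    ultimately show "\<exists>y. ((\<lambda>s. u s l * exp (C * s)) has_real_derivative y) (at s) \<and> 0 \<le> y" by blast
  next
    show "continuous_on {0..t} (\<lambda>s. u s l * exp (C * s))"
      using l by (intro continuous_intros continuous_on_subset[OF continuous_on_u]) auto
  qed
  then have "0 < u t l * exp (C * t)" using l u_zero[of l] by simp
  then show ?thesis by (simp add: zero_less_mult_iff)
qed

lemma u_strict_antimono: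
  assumes "l > 0" "0 \<le> s" "s < t"
  shows "u t l < u s l"
  using assms u_pos psi_pos
  by (intro DERIV_neg_imp_decreasing_open[where f = "\<lambda>s. u s l"] exI[of _ "- psi (u _ l)"])
    (auto intro!: u_deriv_at continuous_on_subset[OF continuous_on_u])

lemma inj_on_u: "l > 0 \<Longrightarrow> inj_on (\<lambda>t. u t l) {0..}"
  by (rule linorder_inj_onI') (use u_strict_antimono in fastforce)

text \<open>
  While the flow is above \<open>v\<close> it falls at speed at least \<open>\<psi> v > 0\<close>, so staying there until time
  \<open>l / \<psi> v\<close> would bring it down to \<open>0\<close>.
\<close>
lemma u_le_eventually:
  assumes l: "l > 0" and v: "0 < v" "v \<le> l"
  shows "\<exists>t\<ge>0. u t l \<le> v"
proof (rule ccontr)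
  assume "\<not> ?thesis"
  then have gt: "v < u t l" if "0 \<le> t" for t using that by force
  \<comment> \<open>the time at which a path falling from \<open>l\<close> at constant speed \<open>\<psi> v\<close> reaches \<open>0\<close>\<close>
  define T where "T = l / psi v"
  have T: "0 \<le> T" using l psi_pos[OF v(1)] by (simp add: T_def)
  have "u 0 l + psi v * 0 \<ge> u T l + psi v * T"
  proof (rule DERIV_nonpos_imp_decreasing_open[OF T, where f = "\<lambda>s. u s l + psi v * s"])
    fix s assume s: "0 < s" "s < T"
    have "((\<lambda>s. u s l + psi v * s) has_real_derivative - psi (u s l) + psi v) (at s)"
      using l s by (auto intro!: derivative_eq_intros u_deriv_at)
    moreover have "- psi (u s l) + psi v \<le> 0" using psi_mono[of v "u s l"] gt[of s] v s by simp
    ultimately show "\<exists>y. ((\<lambda>s. u s l + psi v * s) has_real_derivative y) (at s) \<and> y \<le> 0" by blast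
  next
    show "continuous_on {0..T} (\<lambda>s. u s l + psi v * s)"
      using l by (intro continuous_intros continuous_on_subset[OF continuous_on_u]) auto
  qed
  then have "u T l \<le> 0" using psi_pos[OF v(1)] u_zero[OF l] by (simp add: T_def)
  then show False using u_pos[OF l T] by simp
qed

lemma image_u: 
  assumes l: "l > 0"
  shows "(\<lambda>t. u t l) ` {0..} = {0<..l}"
proof (intro equalityI subsetI)
  fix v assume "v \<in> {0<..l}"
  then have v: "0 < v" "v \<le> l" by auto
  then obtain t where t: "t \<ge> 0" "u t l \<le> v" using u_le_eventually[OF l] by blast
  have "\<exists>s\<ge>0. s \<le> t \<and> u s l = v"
    using t v l u_zero[OF l]
    by (intro IVT2') (auto intro: continuous_on_subset[OF continuous_on_u[OF l]])
  then show "v \<in> (\<lambda>t. u t l) ` {0..}" by auto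
qed (use l u_pos u_le in auto)

text \<open>
  Under \<open>v = u t l\<close> the Jacobian \<open>\<psi> (u t l)\<close> cancels the denominator \<open>\<psi> v\<close>.
\<close>
lemma time_change:
  assumes l: "l > 0" and x: "x > 0"
  shows "(\<integral>\<^sup>+t\<in>{0..}. ennreal (1 - exp (- x * u t l)) \<partial>lborel) =
    (\<integral>\<^sup>+v\<in>{0<..l}. ennreal ((1 - exp (- x * v)) / psi v) \<partial>lborel)"
proof -
  let ?f = "\<lambda>v. (1 - exp (- x * v)) / psi v"
  have cancel: "\<bar>- psi (u t l)\<bar> * ?f (u t l) = 1 - exp (- x * u t l)" if "0 \<le> t" for t
    using psi_pos[OF u_pos[OF l that]] by (simp add: abs_of_pos field_simps)
  have ind: "indicator {0..} t *\<^sub>R (1 - exp (- x * u t l)) =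
      indicator {0..} t * (\<bar>- psi (u t l)\<bar> * ?f (u t l))" for t
  proof (cases "0 \<le> t")
    case True
    show ?thesis by (simp only: cancel[OF True] real_scaleR_def)
  qed simp
  have "(\<lambda>t. indicator {0..} t *\<^sub>R (1 - exp (- x * u t l))) \<in> borel_measurable borel"
    by (rule borel_measurable_continuous_on_indicator) (auto intro!: continuous_intros continuous_on_u l)
  then have meas: "(\<lambda>t. indicator {0..} t * (\<bar>- psi (u t l)\<bar> * ?f (u t l))) \<in> borel_measurable borel"
    by (simp only: ind)
  have "(\<integral>\<^sup>+t\<in>{0..}. ennreal (1 - exp (- x * u t l)) \<partial>lborel) =
    (\<integral>\<^sup>+t\<in>{0..}. ennreal (\<bar>- psi (u t l)\<bar> * ?f (u t l)) \<partial>lborel)"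
    by (rule set_nn_integral_cong) (simp_all only: cancel atLeast_iff Int_iff)
  also have "\<dots> = (\<integral>\<^sup>+v\<in>(\<lambda>t. u t l) ` {0..}. ennreal (?f v) \<partial>lborel)"
  proof (rule nn_integral_change_of_variables[OF _ u_deriv[OF l] inj_on_u[OF l]])
    show "(\<lambda>y. indicator ((\<lambda>t. u t l) ` {0..}) y * ?f y) \<in> borel_measurable borel"
      unfolding image_u[OF l] by (rule measurable_quotient_psi) auto
    show "0 \<le> ?f (u t l)" if "t \<in> {0..}" for t
      using that x u_pos[OF l, of t] psi_pos[of "u t l"] by simp
  qed (use meas in auto)
  finally show ?thesis unfolding image_u[OF l] .
qed

section \<open>Survival and occupation of the open half line\<close>

lemma space_P: "x \<ge> 0 \<Longrightarrow> space (P x) = space M"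
  by (rule sets_eq_imp_space_eq[OF sets_P])

lemma measurable_Z_P: "x \<ge> 0 \<Longrightarrow> t \<ge> 0 \<Longrightarrow> Z t \<in> borel_measurable (P x)"
  using measurable_Z measurable_cong_sets[OF sets_P refl] by blast

lemma nn_laplace_Z:
  assumes x: "x \<ge> 0" and l: "l > 0" and t: "t \<ge> 0"
  shows "(\<integral>\<^sup>+\<omega>. ennreal (1 - exp (- l * Z t \<omega>)) \<partial>P x) = ennreal (1 - exp (- x * u t l))"
proof -
  interpret prob_space "P x" by (rule prob_P[OF x])
  note [measurable] = measurable_Z_P[OF x t]
  have nn: "0 \<le> Z t \<omega>" if "\<omega> \<in> space (P x)" for \<omega> using that nonneg_Z[OF t] space_P[OF x] by simp
  have int: "integrable (P x) (\<lambda>\<omega>. exp (- l * Z t \<omega>))"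
  proof (rule integrable_const_bound[where B = 1])
    show "AE \<omega> in P x. norm (exp (- l * Z t \<omega>)) \<le> 1"
      by (rule AE_I2) (use nn l in simp)
  qed measurable
  have "(\<integral>\<^sup>+\<omega>. ennreal (1 - exp (- l * Z t \<omega>)) \<partial>P x) = ennreal (\<integral>\<omega>. 1 - exp (- l * Z t \<omega>) \<partial>P x)"
  proof (rule nn_integral_eq_integral)
    show "AE \<omega> in P x. 0 \<le> 1 - exp (- l * Z t \<omega>)"
      by (rule AE_I2) (use nn l in simp)
  qed (intro Bochner_Integration.integrable_diff integrable_const int)
  also have "(\<integral>\<omega>. 1 - exp (- l * Z t \<omega>) \<partial>P x) = 1 - exp (- x * u t l)"
    using int laplace_Z[OF x l t] by (simp add: prob_space)
  finally show ?thesis .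
qed

lemma emeasure_survival:
  assumes x: "x \<ge> 0" and t: "t \<ge> 0"
  shows "emeasure (P x) {\<omega> \<in> space (P x). Z t \<omega> \<in> {0<..}} =
    (SUP n. ennreal (1 - exp (- x * u t (real (Suc n)))))"
proof -
  note [measurable] = measurable_Z_P[OF x t]
  have "emeasure (P x) {\<omega> \<in> space (P x). Z t \<omega> \<in> {0<..}} =
      (\<integral>\<^sup>+\<omega>. indicator {\<omega> \<in> space (P x). Z t \<omega> \<in> {0<..}} \<omega> \<partial>P x)" by simp
  also have "\<dots> = (\<integral>\<^sup>+\<omega>. indicator {0<..} (Z t \<omega>) \<partial>P x)"
    by (intro nn_integral_cong) (auto simp: indicator_def)
  also have "\<dots> = (\<integral>\<^sup>+\<omega>. (SUP n. ennreal (1 - exp (- real (Suc n) * Z t \<omega>))) \<partial>P x)"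
    using nonneg_Z[OF t] by (intro nn_integral_cong SUP_one_minus_exp[symmetric]) (simp add: space_P[OF x])
  also have "\<dots> = (SUP n. \<integral>\<^sup>+\<omega>. ennreal (1 - exp (- real (Suc n) * Z t \<omega>)) \<partial>P x)"
    using nonneg_Z[OF t]
    by (intro nn_integral_monotone_convergence_SUP_AE AE_I2 ennreal_leI)
      (auto simp: space_P[OF x] mult_right_mono)
  also have "\<dots> = (SUP n. ennreal (1 - exp (- x * u t (real (Suc n)))))"
    by (intro SUP_cong refl nn_laplace_Z x t) simp
  finally show ?thesis .
qed

text \<open>
  Monotonicity in the starting point is read off from the Laplace transform under \<open>P 1\<close>, without
  a comparison theorem for the differential equation.
\<close>
lemma u_mono:
  assumes l: "0 < l" "l \<le> l'" and t: "t \<ge> 0"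
  shows "u t l \<le> u t l'"
proof -
  have "(\<integral>\<^sup>+\<omega>. ennreal (1 - exp (- l * Z t \<omega>)) \<partial>P 1) \<le> (\<integral>\<^sup>+\<omega>. ennreal (1 - exp (- l' * Z t \<omega>)) \<partial>P 1)"
    using l nonneg_Z[OF t]
    by (intro nn_integral_mono ennreal_leI) (auto simp: space_P mult_right_mono)
  then have "ennreal (1 - exp (- u t l)) \<le> ennreal (1 - exp (- u t l'))"
    using nn_laplace_Z[of 1 l t] nn_laplace_Z[of 1 l' t] l t by simp
  moreover have "0 \<le> 1 - exp (- u t l')" using u_nonneg[of l' t] l t by simp
  ultimately show ?thesis by (simp add: ennreal_le_iff)
qed

text \<open>
  Monotone convergence is used twice, on the time side along the Laplace parameters \<open>n + 1\<close>
  and on the side of \<open>\<psi>\<close> along the intervals \<open>(0, n + 1]\<close>; \<open>time_change\<close> identifies the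
  approximations.
\<close>
lemma occupation_eq_integral:
  assumes x: "x > 0"
  shows "(\<integral>\<^sup>+t\<in>{0..}. emeasure (P x) {\<omega> \<in> space (P x). Z t \<omega> \<in> {0<..}} \<partial>lborel) =
    (\<integral>\<^sup>+v\<in>{0<..}. ennreal ((1 - exp (- x * v)) / psi v) \<partial>lborel)"
proof -
  let ?f = "\<lambda>v. (1 - exp (- x * v)) / psi v"
  define F where "F n t = ennreal (indicator {0..} t *\<^sub>R (1 - exp (- x * u t (real (Suc n)))))" for n t
  define H where "H n v = ennreal (indicator {0<..real (Suc n)} v * ?f v)" for n v
  have F: "F n t = ennreal (1 - exp (- x * u t (real (Suc n)))) * indicator {0..} t" for n t
    by (simp add: F_def indicator_def)
  have H: "H n v = ennreal (?f v) * indicator {0<..real (Suc n)} v" for n v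
    by (simp add: H_def indicator_def)
  have [measurable]: "F n \<in> borel_measurable lborel" for n
    unfolding F_def measurable_lborel2
    by (intro measurable_compose[OF borel_measurable_continuous_on_indicator measurable_ennreal]
        continuous_intros continuous_on_u) auto
  have [measurable]: "H n \<in> borel_measurable lborel" for n
    unfolding H_def measurable_lborel2
    by (rule measurable_compose[OF measurable_quotient_psi measurable_ennreal]) auto
  have "(\<integral>\<^sup>+t\<in>{0..}. emeasure (P x) {\<omega> \<in> space (P x). Z t \<omega> \<in> {0<..}} \<partial>lborel) =
      (\<integral>\<^sup>+t. (SUP n. F n t) \<partial>lborel)"
  proof (rule nn_integral_cong)
    fix t :: real
    show "emeasure (P x) {\<omega> \<in> space (P x). Z t \<omega> \<in> {0<..}} * indicator {0..} t = (SUP n. F n t)"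
    proof (cases "0 \<le> t")
      case True
      then show ?thesis
        unfolding F using emeasure_survival[OF less_imp_le[OF x] True] by simp
    qed (simp add: F)
  qed
  also have "\<dots> = (SUP n. \<integral>\<^sup>+t. F n t \<partial>lborel)"
  proof (intro nn_integral_monotone_convergence_SUP_AE AE_I2)
    show "F n t \<le> F (Suc n) t" for n t
      using x u_mono[of "real (Suc n)" "real (Suc (Suc n))" t]
      by (auto simp: F indicator_def intro!: ennreal_leI mult_left_mono)
  qed measurable
  also have "\<dots> = (SUP n. \<integral>\<^sup>+v. H n v \<partial>lborel)"
    unfolding F H using x by (intro SUP_cong refl time_change) auto
  also have "\<dots> = (\<integral>\<^sup>+v. (SUP n. H n v) \<partial>lborel)"
  proof (intro nn_integral_monotone_convergence_SUP_AE[symmetric] AE_I2)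
    show "H n v \<le> H (Suc n) v" for n v by (auto simp: H indicator_def)
  qed measurable
  also have "\<dots> = (\<integral>\<^sup>+v\<in>{0<..}. ennreal (?f v) \<partial>lborel)"
  proof (rule nn_integral_cong)
    fix v :: real
    show "(SUP n. H n v) = ennreal (?f v) * indicator {0<..} v"
    proof (cases "v > 0")
      case True
      obtain m where m: "v \<le> real m" using real_arch_simple by blast
      show ?thesis
      proof (rule antisym)
        show "(SUP n. H n v) \<le> ennreal (?f v) * indicator {0<..} v"
          by (rule SUP_least) (auto simp: H indicator_def)
        have "ennreal (?f v) * indicator {0<..} v = H m v" using m True by (simp add: H indicator_def)
        also have "\<dots> \<le> (SUP n. H n v)" by (rule SUP_upper) simp
        finally show "ennreal (?f v) * indicator {0<..} v \<le> (SUP n. H n v)" .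
      qed
    qed (simp add: H)
  qed
  finally show ?thesis .
qed

text \<open>
  By absorption, \<open>Z\<close> is positive at every time in \<open>(0, \<zeta>)\<close> and vanishes at every time after \<open>\<zeta>\<close>.
  The times \<open>0\<close> and \<open>\<zeta>\<close> themselves form a null set, so the values there do not matter.
\<close>
lemma extinction_time_eq_occupation:
  assumes \<omega>: "\<omega> \<in> space M"
  shows "extinction_time Z \<omega> = (\<integral>\<^sup>+t\<in>{0..}. indicator {0<..} (Z t \<omega>) \<partial>lborel)"
proof -
  let ?z = "extinction_time Z \<omega>"
  have before: "Z t \<omega> > 0" if "0 < t" "ennreal t < ?z" for t
  proof -
    have "Z t \<omega> \<noteq> 0"
    proof
      assume "Z t \<omega> = 0"
      then have "?z \<le> ennreal t" using that unfolding extinction_time_def by (intro Inf_lower) auto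
      then show False using that by simp
    qed
    then show ?thesis using nonneg_Z[of t \<omega>] that \<omega> by simp
  qed
  have after: "Z t \<omega> = 0" if "0 \<le> t" "?z < ennreal t" for t
  proof -
    obtain s where s: "0 < s" "Z s \<omega> = 0" "ennreal s < ennreal t"
      using \<open>?z < ennreal t\<close> unfolding extinction_time_def Inf_less_iff by blast
    then show ?thesis using absorbed_Z[of s t \<omega>] that \<omega> by (simp add: ennreal_less_iff)
  qed
  show ?thesis
  proof (cases ?z)
    case (real z)
    have "ennreal z = emeasure lborel {0<..<z}" using real by simp
    also have "\<dots> = (\<integral>\<^sup>+t. indicator {0<..<z} t \<partial>lborel)" by simp
    also have "\<dots> \<le> (\<integral>\<^sup>+t\<in>{0..}. indicator {0<..} (Z t \<omega>) \<partial>lborel)"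
      using before real by (intro nn_integral_mono) (auto simp: indicator_def ennreal_less_iff)
    finally have 1: "ennreal z \<le> (\<integral>\<^sup>+t\<in>{0..}. indicator {0<..} (Z t \<omega>) \<partial>lborel)" .
    have "(\<integral>\<^sup>+t\<in>{0..}. indicator {0<..} (Z t \<omega>) \<partial>lborel) \<le> (\<integral>\<^sup>+t. indicator {0..z} t \<partial>lborel)"
      using after real by (intro nn_integral_mono) (force simp: indicator_def ennreal_less_iff)
    also have "\<dots> = ennreal z" using real by simp
    finally show ?thesis using 1 real by simp
  next
    case top
    have "of_nat n \<le> (\<integral>\<^sup>+t\<in>{0..}. indicator {0<..} (Z t \<omega>) \<partial>lborel)" for n
    proof -
      have "of_nat n = emeasure lborel {0<..<real n}" by (simp add: ennreal_of_nat_eq_real_of_nat)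
      also have "\<dots> = (\<integral>\<^sup>+t. indicator {0<..<real n} t \<partial>lborel)" by simp
      also have "\<dots> \<le> (\<integral>\<^sup>+t\<in>{0..}. indicator {0<..} (Z t \<omega>) \<partial>lborel)"
        using before top by (intro nn_integral_mono) (auto simp: indicator_def)
      finally show ?thesis .
    qed
    then have "(SUP n. of_nat n) \<le> (\<integral>\<^sup>+t\<in>{0..}. indicator {0<..} (Z t \<omega>) \<partial>lborel)"
      by (rule SUP_least)
    then show ?thesis using top by (simp add: ennreal_SUP_of_nat_eq_top top_unique)
  qed
qed

text \<open>
  Tonelli applies because right continuity makes \<open>Z\<close> jointly measurable. The cut-off \<open>max 0 t\<close>
  is there because nothing is known about \<open>Z\<close> at negative times.
\<close>
lemma expected_extinction_time_eq_occupation: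
  assumes x: "x \<ge> 0"
  shows "(\<integral>\<^sup>+\<omega>. extinction_time Z \<omega> \<partial>P x) =
    (\<integral>\<^sup>+t\<in>{0..}. emeasure (P x) {\<omega> \<in> space (P x). Z t \<omega> \<in> {0<..}} \<partial>lborel)"
proof -
  interpret prob_space "P x" by (rule prob_P[OF x])
  interpret pair_sigma_finite lborel "P x" by unfold_locales
  have [measurable]: "(\<lambda>(t, \<omega>). Z (max 0 t) \<omega>) \<in> borel_measurable (borel \<Otimes>\<^sub>M P x)"
    by (rule measurable_right_continuous_process) (auto intro: measurable_Z_P x right_continuous_Z simp: space_P[OF x])
  let ?g = "\<lambda>t \<omega>. indicator {0<..} (Z (max 0 t) \<omega>) * indicator {0..} t :: ennreal"
  have meas: "case_prod ?g \<in> borel_measurable (lborel \<Otimes>\<^sub>M P x)" by measurable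
  have g: "indicator {0<..} (Z t \<omega>) * indicator {0..} t = ?g t \<omega>" for t \<omega>
    by (simp add: indicator_def max_absorb2)
  have "(\<integral>\<^sup>+\<omega>. extinction_time Z \<omega> \<partial>P x) = (\<integral>\<^sup>+\<omega>. (\<integral>\<^sup>+t. ?g t \<omega> \<partial>lborel) \<partial>P x)"
    unfolding g[symmetric]
    by (intro nn_integral_cong extinction_time_eq_occupation) (simp add: space_P[OF x])
  also have "\<dots> = (\<integral>\<^sup>+t. (\<integral>\<^sup>+\<omega>. ?g t \<omega> \<partial>P x) \<partial>lborel)" by (rule Fubini'[OF meas])
  also have "\<dots> = (\<integral>\<^sup>+t\<in>{0..}. emeasure (P x) {\<omega> \<in> space (P x). Z t \<omega> \<in> {0<..}} \<partial>lborel)"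
  proof (rule nn_integral_cong)
    fix t :: real
    show "(\<integral>\<^sup>+\<omega>. ?g t \<omega> \<partial>P x) =
      emeasure (P x) {\<omega> \<in> space (P x). Z t \<omega> \<in> {0<..}} * indicator {0..} t"
    proof (cases "t \<ge> 0")
      case True
      note [measurable] = measurable_Z_P[OF x True]
      have "(\<integral>\<^sup>+\<omega>. ?g t \<omega> \<partial>P x) = (\<integral>\<^sup>+\<omega>. indicator {\<omega> \<in> space (P x). Z t \<omega> \<in> {0<..}} \<omega> \<partial>P x)"
        using True by (intro nn_integral_cong) (auto simp: indicator_def max_absorb2)
      then show ?thesis using True by simp
    qed simp
  qed
  finally show ?thesis .
qed

lemma finite_potential_measure_iff:
  assumes x: "x \<ge> 0"
  shows "finite_measure (potential_measure P Z x) \<longleftrightarrow>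
    (\<integral>\<^sup>+t\<in>{0..}. emeasure (P x) {\<omega> \<in> space (P x). Z t \<omega> \<in> {0<..}} \<partial>lborel) < \<infinity>"
proof -
  have "space (potential_measure P Z x) = {0<..}"
    unfolding potential_measure_def by (rule space_measure_of) (auto simp: sets_restrict_space)
  then have "finite_measure (potential_measure P Z x) \<longleftrightarrow>
      emeasure (potential_measure P Z x) {0<..} \<noteq> \<infinity>"
    using finite_measureI[of "potential_measure P Z x"]
      finite_measure.emeasure_finite[of "potential_measure P Z x" "{0<..}"] by auto
  then show ?thesis
    using emeasure_potential_measure[OF x, of "{0<..}"] by (simp add: top.not_eq_extremum)
qed

end

theorem proposition3p6:
  fixes \<alpha> \<sigma> :: real and \<pi> :: "real measure" and u :: "real \<Rightarrow> real \<Rightarrow> real"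
    and M :: "'w measure" and P :: "real \<Rightarrow> 'w measure" and Z :: "real \<Rightarrow> 'w \<Rightarrow> real"
  assumes "cb_process \<alpha> \<sigma> \<pi> u M P Z"
  shows
    "((\<exists>x>0. finite_measure (potential_measure P Z x)) \<longleftrightarrow>
        (\<forall>x>0. finite_measure (potential_measure P Z x))) \<and>
     ((\<exists>x>0. (\<integral>\<^sup>+\<omega>. extinction_time Z \<omega> \<partial>P x) < \<infinity>) \<longleftrightarrow>
        (\<forall>x>0. (\<integral>\<^sup>+\<omega>. extinction_time Z \<omega> \<partial>P x) < \<infinity>)) \<and>
     ((\<exists>x>0. finite_measure (potential_measure P Z x)) \<longleftrightarrow>
        (\<exists>x>0. (\<integral>\<^sup>+\<omega>. extinction_time Z \<omega> \<partial>P x) < \<infinity>)) \<and>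
     ((\<exists>x>0. (\<integral>\<^sup>+\<omega>. extinction_time Z \<omega> \<partial>P x) < \<infinity>) \<longleftrightarrow>
        (\<exists>e>0. set_integrable lborel {0<..<e} (\<lambda>v. v / branching_mechanism \<alpha> \<sigma> \<pi> v)))"
proof -
  interpret cb_process \<alpha> \<sigma> \<pi> u M P Z by (rule assms)
  let ?C = "\<exists>e>0. set_integrable lborel {0<..<e} (\<lambda>v. v / psi v)"
  have "(\<integral>\<^sup>+\<omega>. extinction_time Z \<omega> \<partial>P x) < \<infinity> \<longleftrightarrow> ?C"
    and "finite_measure (potential_measure P Z x) \<longleftrightarrow> ?C" if "x > 0" for x
    using that extinction_integral_finite_iff[OF that] occupation_eq_integral[OF that]
    by (simp_all add: finite_potential_measure_iff expected_extinction_time_eq_occupation)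
  moreover have "\<exists>x::real. x > 0" by (rule exI[of _ 1]) simp
  ultimately show ?thesis by blast
qed

end
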